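(* Let $C$ be a random element (collecting the fitted calibration mechanism and algorithmic randomness) with law $\mu$, and let $P_0,\widetilde P_0$ be two probability laws for the test document on a common measurable space. Suppose the joint law of ($C$, test document) is $\mu\otimes P_0$ in the reference experiment and $\mu\otimes\widetilde P_0$ in the shifted experiment, so that the test document is independent of $C$ under both. Let the alert event be a measurable subset of the product space, with document section $A_c$ at $C=c$ (so an alert occurs iff the test document lies in $A_C$), and assume reference validity $$\mathbb P_{\mu\otimes P_0}(\text{alert})\le\alpha .$$ Then $$\mathbb P_{\mu\otimes\widetilde P_0}(\text{alert})\le\min\{1,\alpha+\operatorname{TV}(P_0,\widetilde P_0)\}.$$
   Context: Here $0<\alpha<1$, and for probability measures $P,Q$ on a common measurable space $\operatorname{TV}(P,Q)=\sup_B|P(B)-Q(B)|$, the supremum being over measurable sets $B$. *)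

theory Defs
  imports "HOL-Probability.Probability"
begin

(* Intended for probability measures with sets P = sets Q. The supremum is then that of a
   nonempty set of reals bounded by 1, so the conditionally complete SUP on real is the true one. *)
definition TV :: "'a measure \<Rightarrow> 'a measure \<Rightarrow> real" where
  "TV P Q = (SUP B\<in>sets P. \<bar>measure P B - measure Q B\<bar>)"

definition document_section :: "('c \<times> 'd) set \<Rightarrow> 'c \<Rightarrow> 'd set" where
  "document_section A c = {x. (c, x) \<in> A}"

(* Pullback of the alert set A to the sample space of an experiment E in which C is the random
   element and X the test document. *)
definition alert :: "'w measure \<Rightarrow> ('w \<Rightarrow> 'c) \<Rightarrow> ('w \<Rightarrow> 'd) \<Rightarrow> ('c \<times> 'd) set \<Rightarrow> 'w set" where
  "alert E C X A = {\<omega> \<in> space E. X \<omega> \<in> document_section A (C \<omega>)}"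

end

theory Submission
  imports Defs
begin

text \<open>Conditionally on the calibration \<open>C = c\<close> the alert is the event that the test document lies in
  the fixed section \<open>A\<^sub>c\<close>, whose probability changes by at most the total variation distance when
  the document law changes. Integrating over the law of \<open>C\<close>, which is the same in both experiments,
  preserves this bound.\<close>

text \<open>On the reals a supremum is known to dominate its members only if the family is bounded
  above; here 1 is a bound because both measures take values in [0, 1].\<close>

lemma abs_measure_diff_le_TV:
  assumes "prob_space P" and "prob_space Q" and "B \<in> sets P"
  shows "\<bar>measure P B - measure Q B\<bar> \<le> TV P Q"
proof -
  have "\<bar>measure P B' - measure Q B'\<bar> \<le> 1" for B'
    using prob_space.prob_le_1[OF assms(1), of B'] prob_space.prob_le_1[OF assms(2), of B']
      measure_nonneg[of P B'] measure_nonneg[of Q B'] by linarith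
  then have "bdd_above ((\<lambda>B. \<bar>measure P B - measure Q B\<bar>) ` sets P)"
    by (rule bdd_aboveI2)
  with assms(3) show ?thesis
    unfolding TV_def by (rule cSUP_upper)
qed

text \<open>The empty set already contributes the value 0. This sign lets \<open>ennreal\<close>
  commute with the sums involving \<open>TV P Q\<close> below.\<close>

lemma TV_nonneg:
  assumes "prob_space P" and "prob_space Q"
  shows "0 \<le> TV P Q"
  using abs_measure_diff_le_TV[OF assms sets.empty_sets] by simp

lemma measure_pair_le_add_TV:
  assumes "prob_space M" and P: "prob_space P" and Q: "prob_space Q"
    and sets_eq: "sets Q = sets P" and A: "A \<in> sets (M \<Otimes>\<^sub>M P)"
  shows "measure (M \<Otimes>\<^sub>M Q) A \<le> measure (M \<Otimes>\<^sub>M P) A + TV P Q"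
proof -
  interpret M: prob_space M by fact
  interpret P: prob_space P by fact
  interpret Q: prob_space Q by fact
  interpret MP: pair_prob_space M P ..
  interpret MQ: pair_prob_space M Q ..
  have A': "A \<in> sets (M \<Otimes>\<^sub>M Q)"
    using A by (simp add: sets_eq cong: sets_pair_measure_cong)
  \<comment> \<open>Every section of \<open>A\<close> is measurable, also for \<open>c\<close>
    outside \<open>space M\<close>, where it is empty; hence the bound is uniform in
    \<open>c\<close>. It is stated in \<open>ennreal\<close> so that the integration over
    \<open>c\<close> needs no integrability argument.\<close>
  have section_le: "emeasure Q (Pair c -` A) \<le> emeasure P (Pair c -` A) + ennreal (TV P Q)" for c
  proof -
    have "measure Q (Pair c -` A) \<le> measure P (Pair c -` A) + TV P Q"
      using abs_measure_diff_le_TV[OF P Q sets_Pair1[OF A, of c]] by linarith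
    then show ?thesis
      by (simp add: P.emeasure_eq_measure Q.emeasure_eq_measure TV_nonneg[OF P Q]
          flip: ennreal_plus)
  qed
  have "emeasure (M \<Otimes>\<^sub>M Q) A = (\<integral>\<^sup>+c. emeasure Q (Pair c -` A) \<partial>M)"
    using A' by (rule Q.emeasure_pair_measure_alt)
  also have "\<dots> \<le> (\<integral>\<^sup>+c. emeasure P (Pair c -` A) + ennreal (TV P Q) \<partial>M)"
    by (intro nn_integral_mono section_le)
  \<comment> \<open>The constant integrates to itself since \<open>M\<close> has total mass 1;
    splitting the integral uses measurability of the section mass in \<open>c\<close>.\<close>
  also have "\<dots> = (\<integral>\<^sup>+c. emeasure P (Pair c -` A) \<partial>M) + ennreal (TV P Q)"
    using P.measurable_emeasure_Pair[OF A] by (simp add: nn_integral_add M.emeasure_space_1)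
  also have "\<dots> = emeasure (M \<Otimes>\<^sub>M P) A + ennreal (TV P Q)"
    using P.emeasure_pair_measure_alt[OF A] by simp
  finally show ?thesis
    by (simp add: MP.emeasure_eq_measure MQ.emeasure_eq_measure TV_nonneg[OF P Q]
        flip: ennreal_plus)
qed

text \<open>The alert event is the preimage of \<open>A\<close> under the pair (\<open>C\<close>,
  \<open>X\<close>), whose law is the product by assumption. This moves both experiments to product
  measures with the common factor \<open>M\<close>.\<close>

lemma measure_alert:
  assumes "C \<in> measurable E M" and "X \<in> measurable E P"
    and "distr E (M \<Otimes>\<^sub>M P) (\<lambda>\<omega>. (C \<omega>, X \<omega>)) = M \<Otimes>\<^sub>M P" and "A \<in> sets (M \<Otimes>\<^sub>M P)"
  shows "measure E (alert E C X A) = measure (M \<Otimes>\<^sub>M P) A"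
proof -
  have "(\<lambda>\<omega>. (C \<omega>, X \<omega>)) \<in> measurable E (M \<Otimes>\<^sub>M P)"
    using assms(1,2) by (rule measurable_Pair)
  moreover have "alert E C X A = (\<lambda>\<omega>. (C \<omega>, X \<omega>)) -` A \<inter> space E"
    by (auto simp: alert_def document_section_def)
  ultimately have "measure E (alert E C X A)
      = measure (distr E (M \<Otimes>\<^sub>M P) (\<lambda>\<omega>. (C \<omega>, X \<omega>))) A"
    using assms(4) by (simp add: measure_distr)
  with assms(3) show ?thesis by simp
qed

theorem proposition6p3:
  fixes \<alpha> :: real
    and \<mu> :: "'c measure"
    and P\<^sub>0 Pt\<^sub>0 :: "'d measure"
    and Ref :: "'w measure" and C :: "'w \<Rightarrow> 'c" and X :: "'w \<Rightarrow> 'd"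
    and Shift :: "'v measure" and C' :: "'v \<Rightarrow> 'c" and X' :: "'v \<Rightarrow> 'd"
    and A :: "('c \<times> 'd) set"
  assumes "0 < \<alpha>" and "\<alpha> < 1"
    and "prob_space \<mu>" and "prob_space P\<^sub>0" and "prob_space Pt\<^sub>0"
    and "sets Pt\<^sub>0 = sets P\<^sub>0"
    and "prob_space Ref" and "C \<in> measurable Ref \<mu>" and "X \<in> measurable Ref P\<^sub>0"
    and "distr Ref (\<mu> \<Otimes>\<^sub>M P\<^sub>0) (\<lambda>\<omega>. (C \<omega>, X \<omega>)) = \<mu> \<Otimes>\<^sub>M P\<^sub>0"
    and "prob_space Shift" and "C' \<in> measurable Shift \<mu>" and "X' \<in> measurable Shift Pt\<^sub>0"
    and "distr Shift (\<mu> \<Otimes>\<^sub>M Pt\<^sub>0) (\<lambda>\<omega>. (C' \<omega>, X' \<omega>)) = \<mu> \<Otimes>\<^sub>M Pt\<^sub>0"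
    and "A \<in> sets (\<mu> \<Otimes>\<^sub>M P\<^sub>0)"
    and "measure Ref (alert Ref C X A) \<le> \<alpha>"
  shows "measure Shift (alert Shift C' X' A) \<le> min 1 (\<alpha> + TV P\<^sub>0 Pt\<^sub>0)"
proof -
  have A': "A \<in> sets (\<mu> \<Otimes>\<^sub>M Pt\<^sub>0)"
    using assms by (simp cong: sets_pair_measure_cong)
  have "measure Shift (alert Shift C' X' A) = measure (\<mu> \<Otimes>\<^sub>M Pt\<^sub>0) A"
    using assms A' by (intro measure_alert)
  also have "\<dots> \<le> measure (\<mu> \<Otimes>\<^sub>M P\<^sub>0) A + TV P\<^sub>0 Pt\<^sub>0"
    using assms by (intro measure_pair_le_add_TV)
  also have "measure (\<mu> \<Otimes>\<^sub>M P\<^sub>0) A = measure Ref (alert Ref C X A)"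
    using assms by (intro measure_alert[symmetric])
  \<comment> \<open>Reference validity bounds the first summand by \<open>\<alpha>\<close>; the
    bound 1 holds because \<open>Shift\<close> is a probability space.\<close>
  finally show ?thesis
    using assms(16) prob_space.prob_le_1[OF assms(11)] by simp
qed

end
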